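(* Let $G=(V,E)$ be a graph with $|V|=n$ in which all vertices have degree $\sim d$ and every pair of vertices has codegree $\sim d^2/n\gg \log n$. Then for any fixed number of colors $r\ge 2$, \[ \kappa_{r,2}(G)\sim\left(1-\frac1r\right)\frac{d^2}{n}. \]
   Context: Here $G=G_n$ is a sequence of graphs and $d=d(n)$; asymptotics are as $n\to\infty$, $f\sim g$ means $f=(1+o(1))g$ and $f\gg g$ means $g=o(f)$. The codegree of two vertices is the number of their common neighbors. A path is alternating (with respect to an edge-coloring) if no two consecutive edges have the same color; the length of a path is its number of edges. $\kappa_{r,\ell}(G)$ is the maximum $t$ such that there is an $r$-edge-coloring of $G$ in which every pair of distinct vertices is connected by $t$ internally vertex-disjoint alternating paths of length $\ell$. *)

theory Defs
  imports Complex_Main "HOL-Library.Landau_Symbols"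
begin

unbundle asymp_equiv_syntax

definition simple_graph :: "'a set \<Rightarrow> 'a set set \<Rightarrow> bool" where
  "simple_graph V E \<longleftrightarrow> finite V \<and> (\<forall>e\<in>E. e \<subseteq> V \<and> card e = 2)"

definition neighbors :: "'a set set \<Rightarrow> 'a \<Rightarrow> 'a set" where
  "neighbors E v = {w. {v, w} \<in> E}"

definition vertex_degree :: "'a set set \<Rightarrow> 'a \<Rightarrow> nat" where
  "vertex_degree E v = card (neighbors E v)"

definition codegree :: "'a set set \<Rightarrow> 'a \<Rightarrow> 'a \<Rightarrow> nat" where
  "codegree E u v = card (neighbors E u \<inter> neighbors E v)"

(* Colorings need be neither proper nor onto the colors. *)
definition edge_coloring :: "nat \<Rightarrow> 'a set set \<Rightarrow> ('a set \<Rightarrow> nat) \<Rightarrow> bool" where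
  "edge_coloring r E c \<longleftrightarrow> (\<forall>e\<in>E. c e < r)"

definition is_path :: "'a set \<Rightarrow> 'a set set \<Rightarrow> nat \<Rightarrow> 'a \<Rightarrow> 'a \<Rightarrow> 'a list \<Rightarrow> bool" where
  "is_path V E l u v p \<longleftrightarrow>
     length p = l + 1 \<and> hd p = u \<and> last p = v \<and> distinct p \<and> set p \<subseteq> V \<and>
     (\<forall>i<l. {p ! i, p ! (i + 1)} \<in> E)"

definition alternating :: "('a set \<Rightarrow> nat) \<Rightarrow> 'a list \<Rightarrow> bool" where
  "alternating c p \<longleftrightarrow>
     (\<forall>i. i + 2 < length p \<longrightarrow> c {p ! i, p ! (i + 1)} \<noteq> c {p ! (i + 1), p ! (i + 2)})"

definition path_interior :: "'a list \<Rightarrow> 'a set" where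
  "path_interior p = set (butlast (tl p))"

definition alt_connected ::
  "'a set \<Rightarrow> 'a set set \<Rightarrow> ('a set \<Rightarrow> nat) \<Rightarrow> nat \<Rightarrow> nat \<Rightarrow> 'a \<Rightarrow> 'a \<Rightarrow> bool" where
  "alt_connected V E c l t u v \<longleftrightarrow>
     (\<exists>P. finite P \<and> card P = t \<and>
          (\<forall>p\<in>P. is_path V E l u v p \<and> alternating c p) \<and>
          (\<forall>p\<in>P. \<forall>q\<in>P. p \<noteq> q \<longrightarrow> path_interior p \<inter> path_interior q = {}))"

definition kappa_set :: "nat \<Rightarrow> nat \<Rightarrow> 'a set \<Rightarrow> 'a set set \<Rightarrow> nat set" where
  "kappa_set r l V E =
     {t. \<exists>c. edge_coloring r E c \<and>
             (\<forall>u\<in>V. \<forall>v\<in>V. u \<noteq> v \<longrightarrow> alt_connected V E c l t u v)}"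

(* Meaningful for graphs with at least two vertices and r > 0, see the two lemmas below.
   With fewer vertices every t qualifies vacuously and there is no maximum. *)
definition kappa :: "nat \<Rightarrow> nat \<Rightarrow> 'a set \<Rightarrow> 'a set set \<Rightarrow> nat" where
  "kappa r l V E = Max (kappa_set r l V E)"

lemma zero_in_kappa_set: "r > 0 \<Longrightarrow> 0 \<in> kappa_set r l V E"
  unfolding kappa_set_def edge_coloring_def alt_connected_def
  by (auto intro!: exI[of _ "\<lambda>_. 0"] exI[of _ "{}"])

lemma finite_kappa_set:
  assumes "simple_graph V E" and "card V \<ge> 2"
  shows "finite (kappa_set r l V E)"
proof -
  have fin: "finite V" using assms(1) by (simp add: simple_graph_def)
  obtain u v where uv: "u \<in> V" "v \<in> V" "u \<noteq> v"
    using assms(2) card_le_Suc0_iff_eq[OF fin] by fastforce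
  define L where "L = {p. set p \<subseteq> V \<and> length p = l + 1}"
  have "finite L" unfolding L_def by (rule finite_lists_length_eq[OF fin])
  have "t \<le> card L" if t: "t \<in> kappa_set r l V E" for t
  proof -
    obtain P where "card P = t" "\<forall>p\<in>P. is_path V E l u v p"
      using t uv unfolding kappa_set_def alt_connected_def by blast
    moreover from this have "P \<subseteq> L" unfolding L_def is_path_def by auto
    ultimately show ?thesis using card_mono[OF \<open>finite L\<close>] by auto
  qed
  then show ?thesis by (meson finite_nat_set_iff_bounded_le)
qed

(* f n x = (1 + o(1)) g n with the error uniform over x in A n *)
definition unif_asymp_equiv ::
  "(nat \<Rightarrow> 'b set) \<Rightarrow> (nat \<Rightarrow> 'b \<Rightarrow> real) \<Rightarrow> (nat \<Rightarrow> real) \<Rightarrow> bool" where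
  "unif_asymp_equiv A f g \<longleftrightarrow>
     (\<forall>\<epsilon>>0. \<forall>\<^sub>F n in at_top. \<forall>x\<in>A n. \<bar>f n x - g n\<bar> \<le> \<epsilon> * \<bar>g n\<bar>)"

end

theory Submission
  imports Defs "HOL-Probability.Hoeffding" "HOL-Probability.Product_PMF"
begin

text \<open>
  Alternating paths of length 2 between \<open>u\<close> and \<open>v\<close> correspond to common neighbours \<open>w\<close>
  with \<open>c {u, w} \<noteq> c {v, w}\<close>, and are automatically internally disjoint.

  Upper bound: at a vertex \<open>w\<close> of degree about \<open>d\<close>, Cauchy--Schwarz over the color classes leaves at
  most about \<open>(1 - 1/r) d\<^sup>2\<close> ordered pairs of differently colored edges, so averaging over the
  \<open>n (n - 1)\<close> ordered pairs \<open>(u, v)\<close> bounds the worst pair.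

  Lower bound: in a uniformly random coloring the common neighbours of \<open>u\<close> and \<open>v\<close> use disjoint
  pairs of edges, so their alternation events are independent of probability \<open>1 - 1/r\<close>.
  Hoeffding's inequality and \<open>d\<^sup>2/n\<close> dominating \<open>ln n\<close> beat the union bound over the \<open>n\<^sup>2\<close> pairs.
\<close>

section \<open>Alternating paths of length 2 and their middle vertices\<close>

definition alt_mids :: "'a set set \<Rightarrow> ('a set \<Rightarrow> nat) \<Rightarrow> 'a \<Rightarrow> 'a \<Rightarrow> 'a set" where
  "alt_mids E c u v = {w \<in> neighbors E u \<inter> neighbors E v. c {u, w} \<noteq> c {v, w}}"

lemma neighbors_subset:
  assumes "simple_graph V E"
  shows "neighbors E v \<subseteq> V - {v}"
  using assms by (auto simp: simple_graph_def neighbors_def)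

lemma finite_neighbors:
  assumes "simple_graph V E"
  shows "finite (neighbors E v)"
  using neighbors_subset[OF assms, of v] assms by (auto simp: simple_graph_def intro: finite_subset)

lemma neighbors_sym: "w \<in> neighbors E v \<longleftrightarrow> v \<in> neighbors E w"
  by (simp add: neighbors_def insert_commute)

lemma finite_alt_mids:
  assumes "simple_graph V E"
  shows "finite (alt_mids E c u v)"
  using finite_neighbors[OF assms, of u] by (simp add: alt_mids_def)

lemma alternating_path_2_iff:
  assumes G: "simple_graph V E" and "u \<in> V" "v \<in> V" "u \<noteq> v"
  shows "is_path V E 2 u v p \<and> alternating c p \<longleftrightarrow> (\<exists>w\<in>alt_mids E c u v. p = [u, w, v])"
proof
  assume p: "is_path V E 2 u v p \<and> alternating c p"
  then have "length p = 3" by (simp add: is_path_def)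
  then obtain x w y where xwy: "p = [x, w, y]"
    by (auto simp: numeral_eq_Suc length_Suc_conv)
  with p have eq: "p = [u, w, v]" by (auto simp: is_path_def)
  have "{u, w} \<in> E" "{w, v} \<in> E" "c {u, w} \<noteq> c {w, v}"
    using p unfolding eq by (force simp: is_path_def alternating_def numeral_eq_Suc All_less_Suc)+
  then have "w \<in> alt_mids E c u v"
    by (simp add: alt_mids_def neighbors_def insert_commute)
  with eq show "\<exists>w\<in>alt_mids E c u v. p = [u, w, v]" by blast
next
  assume "\<exists>w\<in>alt_mids E c u v. p = [u, w, v]"
  then obtain w where w: "w \<in> alt_mids E c u v" and p: "p = [u, w, v]" by blast
  from w have "w \<in> V" "w \<noteq> u" "w \<noteq> v"
    using neighbors_subset[OF G, of u] neighbors_subset[OF G, of v] by (auto simp: alt_mids_def)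
  with w assms show "is_path V E 2 u v p \<and> alternating c p"
    by (auto simp: p is_path_def alternating_def alt_mids_def neighbors_def insert_commute
        numeral_eq_Suc All_less_Suc)
qed

text \<open>The map sending \<open>w\<close> to \<open>[u, w, v]\<close> is a bijection from
  \<open>alt_mids E c u v\<close> onto the alternating paths of length 2. The interior of such a
  path is \<open>{w}\<close>, so any \<open>t\<close> middle vertices give an admissible family;
  passing to a subset turns "exactly \<open>t\<close> paths" into an inequality.\<close>

lemma alt_connected_2_iff:
  assumes G: "simple_graph V E" and uv: "u \<in> V" "v \<in> V" "u \<noteq> v"
  shows "alt_connected V E c 2 t u v \<longleftrightarrow> t \<le> card (alt_mids E c u v)"
proof
  assume "alt_connected V E c 2 t u v"
  then obtain P where P: "finite P" "card P = t"
    "\<forall>p\<in>P. is_path V E 2 u v p \<and> alternating c p"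
    unfolding alt_connected_def by (elim exE conjE) (rule that)
  have "P \<subseteq> (\<lambda>w. [u, w, v]) ` alt_mids E c u v"
    using P(3) alternating_path_2_iff[OF assms] by blast
  then show "t \<le> card (alt_mids E c u v)"
    using P(2) surj_card_le[OF finite_alt_mids[OF G]] by blast
next
  assume "t \<le> card (alt_mids E c u v)"
  then obtain W where W: "W \<subseteq> alt_mids E c u v" "card W = t" "finite W"
    by (rule obtain_subset_with_card_n)
  show "alt_connected V E c 2 t u v"
    unfolding alt_connected_def
  proof (intro exI conjI)
    show "finite ((\<lambda>w. [u, w, v]) ` W)" using W by simp
    show "card ((\<lambda>w. [u, w, v]) ` W) = t"
      using W by (subst card_image) (auto simp: inj_on_def)
    show "\<forall>p\<in>(\<lambda>w. [u, w, v]) ` W. is_path V E 2 u v p \<and> alternating c p"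
      using W alternating_path_2_iff[OF assms] by blast
  qed (auto simp: path_interior_def)
qed

section \<open>Upper bound by double counting\<close>

lemma card_bichromatic_pairs_le:
  fixes c :: "'b \<Rightarrow> nat"
  assumes N: "finite N" and c: "\<And>x. x \<in> N \<Longrightarrow> c x < r"
  shows "real (card {(x, y) \<in> N \<times> N. c x \<noteq> c y}) \<le> (1 - 1 / real r) * (real (card N))\<^sup>2"
proof (cases "N = {}")
  case False
  then have r: "r > 0" using c by fastforce
  define K where "K i = {x \<in> N. c x = i}" for i
  have NK: "N = (\<Union>i<r. K i)" using c by (auto simp: K_def)
  have cardN: "card N = (\<Sum>i<r. card (K i))"
    unfolding NK by (rule card_UN_disjoint) (use N in \<open>auto simp: K_def\<close>)
  have "{(x, y) \<in> N \<times> N. c x = c y} = (\<Union>i<r. K i \<times> K i)"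
    using c by (auto simp: K_def)
  also have "card \<dots> = (\<Sum>i<r. card (K i \<times> K i))"
    by (rule card_UN_disjoint) (use N in \<open>auto simp: K_def\<close>)
  finally have mono: "card {(x, y) \<in> N \<times> N. c x = c y} = (\<Sum>i<r. (card (K i))\<^sup>2)"
    by (simp add: power2_eq_square card_cartesian_product)
  \<comment> \<open>Cauchy-Schwarz for the \<open>r\<close> class sizes, whose sum is
    \<open>card N\<close>: at least a fraction \<open>1 / r\<close> of all ordered pairs, diagonal
    included, is monochromatic.\<close>
  have "(real (card N))\<^sup>2 \<le> real r * (\<Sum>i<r. (real (card (K i)))\<^sup>2)"
    using sum_squared_le_sum_of_squares[where I = "{..<r}" and f = "\<lambda>i. real (card (K i))"]
    by (simp add: cardN mult.commute)
  then have lower: "(real (card N))\<^sup>2 / real r \<le> real (card {(x, y) \<in> N \<times> N. c x = c y})"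
    using r unfolding mono by (simp add: field_simps)
  have "card N * card N = card (N \<times> N)" by (simp add: card_cartesian_product)
  also have "N \<times> N = {(x, y) \<in> N \<times> N. c x \<noteq> c y} \<union> {(x, y) \<in> N \<times> N. c x = c y}" by auto
  also have "card \<dots> = card {(x, y) \<in> N \<times> N. c x \<noteq> c y} + card {(x, y) \<in> N \<times> N. c x = c y}"
    by (rule card_Un_disjoint) (auto intro: finite_subset[OF _ finite_cartesian_product[OF N N]])
  finally have "(real (card N))\<^sup>2 = real (card {(x, y) \<in> N \<times> N. c x \<noteq> c y})
      + real (card {(x, y) \<in> N \<times> N. c x = c y})"
    unfolding power2_eq_square of_nat_mult[symmetric] of_nat_add[symmetric]
    by (rule arg_cong[where f = real])
  with lower show ?thesis by (simp add: algebra_simps add_divide_distrib)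
qed simp

text \<open>Count the triples \<open>(u, v, w)\<close> with \<open>w \<in> alt_mids E c u v\<close>.
  Grouped by \<open>(u, v)\<close> there are at least \<open>t\<close> for each ordered pair of
  distinct vertices; grouped by \<open>w\<close> there are at most \<open>(1 - 1 / r) * D\<close>
  for each vertex. Cancelling one factor \<open>card V\<close> gives the bound.\<close>

lemma kappa_set_2_upper:
  assumes G: "simple_graph V E" and n: "card V \<ge> 2"
    and deg: "\<And>v. v \<in> V \<Longrightarrow> (real (vertex_degree E v))\<^sup>2 \<le> D" and r: "r > 0"
    and t: "t \<in> kappa_set r 2 V E"
  shows "real t * (real (card V) - 1) \<le> (1 - 1 / real r) * D"
proof -
  have fin: "finite V" using G by (simp add: simple_graph_def)
  obtain c where c: "edge_coloring r E c"
    and conn: "\<And>u v. u \<in> V \<Longrightarrow> v \<in> V \<Longrightarrow> u \<noteq> v \<Longrightarrow> alt_connected V E c 2 t u v"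
    using t unfolding kappa_set_def by blast
  define A where "A = (SIGMA u:V. V - {u})"
  \<comment> \<open>The color condition already forces \<open>x \<noteq> y\<close>, so these pairs
    lie in \<open>A\<close>.\<close>
  define B where "B w = {(x, y) \<in> neighbors E w \<times> neighbors E w. c {x, w} \<noteq> c {y, w}}" for w
  have cardA: "card A = card V * (card V - 1)"
    using fin by (simp add: A_def)
  have finA: "finite A" using fin by (simp add: A_def)
  have finB: "finite (B w)" for w
    unfolding B_def by (rule finite_subset[of _ "neighbors E w \<times> neighbors E w"])
      (auto simp: finite_neighbors[OF G])
  have B: "real (card (B w)) \<le> (1 - 1 / real r) * D" if "w \<in> V" for w
  proof -
    have "c {x, w} < r" if "x \<in> neighbors E w" for x
      using that c by (auto simp: neighbors_def edge_coloring_def insert_commute)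
    then have "real (card (B w)) \<le> (1 - 1 / real r) * (real (vertex_degree E w))\<^sup>2"
      unfolding B_def vertex_degree_def
      using card_bichromatic_pairs_le[OF finite_neighbors[OF G], of w "\<lambda>x. c {x, w}" r] by simp
    also have "\<dots> \<le> (1 - 1 / real r) * D"
      using deg[OF that] r by (intro mult_left_mono) auto
    finally show ?thesis .
  qed
  have "t * card A \<le> (\<Sum>(u, v)\<in>A. card (alt_mids E c u v))"
  proof -
    have "(\<Sum>_\<in>A. t) \<le> (\<Sum>(u, v)\<in>A. card (alt_mids E c u v))"
      by (rule sum_mono) (use conn alt_connected_2_iff[OF G] in \<open>auto simp: A_def\<close>)
    then show ?thesis by (simp add: mult.commute)
  qed
  also have "\<dots> = card (SIGMA p:A. alt_mids E c (fst p) (snd p))"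
    using finA finite_alt_mids[OF G] by (simp add: case_prod_beta)
  \<comment> \<open>Regroup by middle vertex: swapping the components is injective.\<close>
  also have "\<dots> \<le> card (SIGMA w:V. B w)"
  proof (rule card_inj_on_le[where f = "\<lambda>(p, w). (w, p)"])
    show "(\<lambda>(p, w). (w, p)) ` (SIGMA p:A. alt_mids E c (fst p) (snd p)) \<subseteq> (SIGMA w:V. B w)"
      using neighbors_subset[OF G]
      by (fastforce simp: A_def B_def alt_mids_def neighbors_sym)
  qed (use fin finB in \<open>auto simp: inj_on_def\<close>)
  also have "\<dots> = (\<Sum>w\<in>V. card (B w))"
    using fin finB by simp
  finally have "real (t * card A) \<le> (\<Sum>w\<in>V. real (card (B w)))"
    using of_nat_mono by fastforce
  also have "\<dots> \<le> (\<Sum>w\<in>V. (1 - 1 / real r) * D)"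
    by (rule sum_mono) (rule B)
  finally have "real (card V) * (real t * (real (card V) - 1)) \<le> real (card V) * ((1 - 1 / real r) * D)"
    using n by (simp add: cardA of_nat_diff mult_ac)
  then show ?thesis using n by simp
qed

section \<open>Lower bound by a random coloring\<close>

abbreviation random_coloring :: "nat \<Rightarrow> 'a set set \<Rightarrow> ('a set \<Rightarrow> nat) pmf" where
  "random_coloring r E \<equiv> Pi_pmf E 0 (\<lambda>_. pmf_of_set {..<r})"

lemma pair_pmf_of_set:
  assumes "finite A" "A \<noteq> {}" "finite B" "B \<noteq> {}"
  shows "pair_pmf (pmf_of_set A) (pmf_of_set B) = pmf_of_set (A \<times> B)"
  by (rule pmf_eqI) (auto simp: assms pmf_pair indicator_def card_cartesian_product)

text \<open>The colors of two distinct edges are jointly uniform on \<open>r * r\<close> pairs, of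
  which \<open>r\<close> lie on the diagonal.\<close>

lemma prob_random_coloring_neq:
  assumes E: "finite E" "e \<in> E" "f \<in> E" "e \<noteq> f" and r: "r > 0"
  shows "measure_pmf.prob (random_coloring r E) {c. c e \<noteq> c f} = 1 - 1 / real r"
proof -
  let ?p = "pmf_of_set {..<r}"
  have "map_pmf (\<lambda>c. (c e, c f)) (random_coloring r E)
      = map_pmf (\<lambda>c. (c e, c f)) (random_coloring r (insert e (E - {e})))"
    using E by (simp add: insert_absorb)
  \<comment> \<open>Splitting \<open>e\<close> off the product makes its color independent of the
    coloring of \<open>E - {e}\<close>, which still contains \<open>f\<close>.\<close>
  also have "\<dots> = map_pmf (\<lambda>(y, g). (y, g f)) (pair_pmf ?p (random_coloring r (E - {e})))"
    using E by (subst Pi_pmf_insert) (simp_all add: pmf.map_comp comp_def case_prod_unfold E(4)[symmetric])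
  also have "\<dots> = pair_pmf ?p (map_pmf (\<lambda>g. g f) (random_coloring r (E - {e})))"
    using map_pair[of id "\<lambda>g. g f" ?p "random_coloring r (E - {e})"]
    by (simp add: id_def)
  also have "\<dots> = pmf_of_set ({..<r} \<times> {..<r})"
    using E r by (simp add: Pi_pmf_component pair_pmf_of_set lessThan_empty_iff)
  finally have dist: "map_pmf (\<lambda>c. (c e, c f)) (random_coloring r E) = pmf_of_set ({..<r} \<times> {..<r})" .
  have "measure_pmf.prob (random_coloring r E) {c. c e \<noteq> c f}
      = measure_pmf.prob (map_pmf (\<lambda>c. (c e, c f)) (random_coloring r E)) {(i, j). i \<noteq> j}"
    by (simp add: vimage_def)
  also have "\<dots> = real (card ({..<r} \<times> {..<r} \<inter> {(i, j). i \<noteq> j})) / (real r * real r)"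
    using r unfolding dist by (subst measure_pmf_of_set) auto
  also have "{..<r} \<times> {..<r} \<inter> {(i, j). i \<noteq> j} = {..<r} \<times> {..<r} - (\<lambda>i. (i, i)) ` {..<r}"
    by auto
  also have "card \<dots> = r * r - r"
    by (subst card_Diff_subset) (auto simp: card_image inj_on_def)
  also have "real (r * r - r) / (real r * real r) = 1 - 1 / real r"
    using r by (simp add: of_nat_diff field_simps)
  finally show ?thesis .
qed

text \<open>\<open>card (alt_mids E c u v)\<close> is a sum of \<open>card N\<close> independent
  indicators of mean \<open>1 - 1 / r\<close>. Hoeffding for a deviation of
  \<open>\<epsilon> * card N\<close> has exponent
  \<open>- 2 * (\<epsilon> * card N)\<^sup>2 / card N\<close>; positivity of the codegree permits
  the cancellation.\<close>

lemma prob_few_alt_mids: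
  assumes G: "simple_graph V E" and uv: "u \<noteq> v" and r: "r > 0" and \<epsilon>: "\<epsilon> \<ge> 0"
    and pos: "codegree E u v > 0"
  shows "measure_pmf.prob (random_coloring r E)
           {c. real (card (alt_mids E c u v)) \<le> (1 - 1 / real r - \<epsilon>) * real (codegree E u v)}
         \<le> exp (- 2 * \<epsilon>\<^sup>2 * real (codegree E u v))"
proof -
  define N where "N = neighbors E u \<inter> neighbors E v"
  define M where "M = measure_pmf (random_coloring r E)"
  define X :: "'a \<Rightarrow> ('a set \<Rightarrow> nat) \<Rightarrow> real" where "X w c = of_bool (c {u, w} \<noteq> c {v, w})" for w c
  have finN: "finite N" using finite_neighbors[OF G] by (simp add: N_def)
  have finE: "finite E"
    using G by (auto simp: simple_graph_def intro: finite_subset[of _ "Pow V"])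
  have N: "w \<noteq> u" "w \<noteq> v" "{u, w} \<in> E" "{v, w} \<in> E" "{u, w} \<noteq> {v, w}" if "w \<in> N" for w
    using that uv neighbors_subset[OF G, of u] neighbors_subset[OF G, of v]
    by (auto simp: N_def neighbors_def doubleton_eq_iff)
  interpret prob_space M unfolding M_def by (rule measure_pmf.prob_space_axioms)
  have ind0: "indep_vars (\<lambda>_. count_space UNIV) (\<lambda>e c. c e) E"
    unfolding M_def by (rule indep_vars_Pi_pmf[OF finE])
  \<comment> \<open>The indicator of \<open>w\<close> depends only on the block
    \<open>{{u, w}, {v, w}}\<close>. Blocks of different \<open>w\<close> are disjoint because
    \<open>u \<noteq> v\<close> and \<open>w\<close> is neither endpoint, so independence passes
    from edges to blocks.\<close>
  have ind1: "indep_vars (\<lambda>w. PiM {{u, w}, {v, w}} (\<lambda>_. count_space UNIV))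
      (\<lambda>w c. restrict (\<lambda>e. c e) {{u, w}, {v, w}}) N"
    by (rule indep_vars_restrict[OF ind0])
      (use N in \<open>auto simp: disjoint_family_on_def doubleton_eq_iff\<close>)
  have "indep_vars (\<lambda>_. borel)
      (\<lambda>w c. of_bool (restrict (\<lambda>e. c e) {{u, w}, {v, w}} {u, w}
                    \<noteq> restrict (\<lambda>e. c e) {{u, w}, {v, w}} {v, w}) :: real) N"
    by (rule indep_vars_compose2[OF ind1]) measurable
  then have ind: "indep_vars (\<lambda>_. borel) X N"
    by (simp add: X_def[abs_def])
  have mean: "expectation (X w) = 1 - 1 / real r" if "w \<in> N" for w
  proof -
    have "expectation (X w) = expectation (indicator {c. c {u, w} \<noteq> c {v, w}})"
      by (intro Bochner_Integration.integral_cong) (auto simp: X_def)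
    also have "\<dots> = measure_pmf.prob (random_coloring r E) {c. c {u, w} \<noteq> c {v, w}}"
      by (simp add: M_def)
    finally show ?thesis using prob_random_coloring_neq[OF finE N(3,4,5) r] that by simp
  qed
  have mu: "(\<Sum>w\<in>N. expectation (X w)) = (1 - 1 / real r) * real (card N)"
    by (simp add: mean)
  interpret Hoeffding_ineq M N X "\<lambda>_. 0" "\<lambda>_. 1" "\<Sum>w\<in>N. expectation (X w)"
    by unfold_locales (use finN ind in \<open>auto simp: X_def\<close>)
  have cod: "real (codegree E u v) = real (card N)" by (simp add: codegree_def N_def)
  have sumX: "(\<Sum>w\<in>N. X w c) = real (card (alt_mids E c u v))" for c
    using finN by (simp add: X_def alt_mids_def N_def of_bool_def sum.If_cases Int_def conj_ac)
  have "measure_pmf.prob (random_coloring r E)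
           {c. real (card (alt_mids E c u v)) \<le> (1 - 1 / real r - \<epsilon>) * real (codegree E u v)}
      = prob {c \<in> space M. (\<Sum>w\<in>N. X w c) \<le> (\<Sum>w\<in>N. expectation (X w)) - \<epsilon> * real (card N)}"
    unfolding mu sumX cod by (simp add: M_def algebra_simps)
  also have "\<dots> \<le> exp (- 2 * (\<epsilon> * real (card N))\<^sup>2 / (\<Sum>w\<in>N. (1 - 0)\<^sup>2))"
    by (rule Hoeffding_ineq_le) (use \<epsilon> pos cod in auto)
  also have "\<dots> = exp (- 2 * \<epsilon>\<^sup>2 * real (codegree E u v))"
    using pos cod by (simp add: power2_eq_square)
  finally show ?thesis .
qed

text \<open>Probabilistic method: by \<open>small\<close>, the union bound over at most
  \<open>(card V)\<^sup>2\<close> ordered pairs stays below 1, so some coloring in the support is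
  good for all pairs at once. The \<open>+ 1\<close> in the bound on \<open>t\<close> leaves room
  for rounding up.\<close>

lemma kappa_set_2_lower:
  assumes G: "simple_graph V E" and r: "r > 0" and \<epsilon>: "\<epsilon> \<ge> 0" and m: "m > 0"
    and cod: "\<And>u v. u \<in> V \<Longrightarrow> v \<in> V \<Longrightarrow> u \<noteq> v \<Longrightarrow> real (codegree E u v) \<ge> m"
    and small: "(real (card V))\<^sup>2 * exp (- 2 * \<epsilon>\<^sup>2 * m) < 1"
    and t: "real t < (1 - 1 / real r - \<epsilon>) * m + 1" and \<epsilon>r: "\<epsilon> \<le> 1 - 1 / real r"
  shows "t \<in> kappa_set r 2 V E"
proof -
  have fin: "finite V" using G by (simp add: simple_graph_def)
  have finE: "finite E"
    using G by (auto simp: simple_graph_def intro: finite_subset[of _ "Pow V"])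
  let ?M = "random_coloring r E"
  define bad where "bad u v =
    {c. real (card (alt_mids E c u v)) \<le> (1 - 1 / real r - \<epsilon>) * real (codegree E u v)}" for u v
  define A where "A = (SIGMA u:V. V - {u})"
  have finA: "finite A" using fin by (simp add: A_def)
  have "card A \<le> card (V \<times> V)"
    by (rule card_mono) (use fin in \<open>auto simp: A_def\<close>)
  then have cardA: "real (card A) \<le> (real (card V))\<^sup>2"
    by (metis card_cartesian_product of_nat_mono of_nat_mult power2_eq_square)
  have "measure_pmf.prob ?M (\<Union>(u, v)\<in>A. bad u v) \<le> (\<Sum>(u, v)\<in>A. measure_pmf.prob ?M (bad u v))"
    using measure_pmf.finite_measure_subadditive_finite[OF finA, of "\<lambda>(u, v). bad u v" ?M]
    by (simp add: case_prod_beta)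
  also have "\<dots> \<le> (\<Sum>(u, v)\<in>A. exp (- 2 * \<epsilon>\<^sup>2 * m))"
  proof (rule sum_mono, clarify)
    fix u v assume "(u, v) \<in> A"
    then have c: "u \<noteq> v" "real (codegree E u v) \<ge> m" using cod by (auto simp: A_def)
    with m have "codegree E u v > 0" by (simp add: zero_less_iff_neq_zero)
    then have "measure_pmf.prob ?M (bad u v) \<le> exp (- 2 * \<epsilon>\<^sup>2 * real (codegree E u v))"
      unfolding bad_def by (rule prob_few_alt_mids[OF G c(1) r \<epsilon>])
    also have "\<dots> \<le> exp (- 2 * \<epsilon>\<^sup>2 * m)"
      using c(2) by (simp add: mult_left_mono)
    finally show "measure_pmf.prob ?M (bad u v) \<le> exp (- 2 * \<epsilon>\<^sup>2 * m)" .
  qed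
  also have "\<dots> \<le> (real (card V))\<^sup>2 * exp (- 2 * \<epsilon>\<^sup>2 * m)"
    using cardA by simp
  finally have "measure_pmf.prob ?M (\<Union>(u, v)\<in>A. bad u v) < 1"
    using small by linarith
  \<comment> \<open>Otherwise the union of the bad events would have probability 1.\<close>
  then have "\<not> set_pmf ?M \<subseteq> (\<Union>(u, v)\<in>A. bad u v)"
    using measure_pmf.prob_eq_1[of "\<Union>(u, v)\<in>A. bad u v" ?M] by (auto simp: AE_measure_pmf_iff)
  then obtain c where c: "c \<in> set_pmf ?M" and good: "\<And>u v. (u, v) \<in> A \<Longrightarrow> c \<notin> bad u v"
    by blast
  \<comment> \<open>Functions in the support take values in \<open>{..<r}\<close> on
    \<open>E\<close> and the default 0 elsewhere.\<close>
  have "edge_coloring r E c"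
    using c r finE by (auto simp: set_Pi_pmf PiE_dflt_def edge_coloring_def lessThan_empty_iff)
  moreover have "alt_connected V E c 2 t u v" if uv: "u \<in> V" "v \<in> V" "u \<noteq> v" for u v
  proof -
    \<comment> \<open>The factor is nonnegative by \<open>\<epsilon>r\<close>. Avoiding
      \<open>bad\<close> gives a strict inequality, so the integer \<open>t\<close>, being less than
      the number of middle vertices plus 1, is at most that number.\<close>
    have "(1 - 1 / real r - \<epsilon>) * m \<le> (1 - 1 / real r - \<epsilon>) * real (codegree E u v)"
      using cod[OF uv] \<epsilon>r by (intro mult_left_mono) auto
    also have "\<dots> < real (card (alt_mids E c u v))"
      using good[of u v] uv by (simp add: bad_def A_def)
    finally have "real t < real (card (alt_mids E c u v)) + 1" using t by linarith
    then show ?thesis using alt_connected_2_iff[OF G uv] by simp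
  qed
  ultimately show ?thesis unfolding kappa_set_def by blast
qed

section \<open>Choice of error terms and the asymptotic statement\<close>

theorem theorem3p1:
  fixes V :: "nat \<Rightarrow> 'a set" and E :: "nat \<Rightarrow> 'a set set"
    and d :: "nat \<Rightarrow> real" and r :: nat
  assumes graph: "\<And>n. simple_graph (V n) (E n)"
    and order: "\<And>n. card (V n) = n"
    and degrees: "unif_asymp_equiv V (\<lambda>n v. real (vertex_degree (E n) v)) d"
    and codegrees: "unif_asymp_equiv (\<lambda>n. {(u, v). u \<in> V n \<and> v \<in> V n \<and> u \<noteq> v})
           (\<lambda>n (u, v). real (codegree (E n) u v)) (\<lambda>n. (d n)\<^sup>2 / real n)"
    and large: "(\<lambda>n. ln (real n)) \<in> o(\<lambda>n. (d n)\<^sup>2 / real n)"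
    and colors: "r \<ge> 2"
  shows "(\<lambda>n. real (kappa r 2 (V n) (E n))) \<sim>[at_top]
           (\<lambda>n. (1 - 1 / real r) * ((d n)\<^sup>2 / real n))"
  unfolding asymp_equiv_altdef
proof (rule landau_o.smallI)
  fix \<delta> :: real assume \<delta>: "\<delta> > 0"
  define a where "a = 1 - 1 / real r"
  have a: "1 / 2 \<le> a" "a < 1" using colors by (auto simp: a_def field_simps)
  \<comment> \<open>The 7 comes from \<open>(1 + \<epsilon>) ^ 3 \<le> 1 + 7 * \<epsilon>\<close>
    for \<open>\<epsilon> \<le> 1\<close>; the bound \<open>1 / 2\<close> keeps
    \<open>1 - \<epsilon> \<ge> 1 / 2\<close> and \<open>\<epsilon> \<le> a\<close>.\<close>
  define \<epsilon> where "\<epsilon> = min (1 / 2) (\<delta> / 7)"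
  have \<epsilon>: "0 < \<epsilon>" "\<epsilon> \<le> 1 / 2" "7 * \<epsilon> \<le> \<delta>" using \<delta> by (auto simp: \<epsilon>_def)
  \<comment> \<open>Three factors \<open>1 + \<epsilon>\<close> are lost in the upper bound: two
    from the squared degree, one from replacing \<open>n\<close> by \<open>n - 1\<close>.\<close>
  have cube: "(1 + \<epsilon>) ^ 3 \<le> 1 + \<delta>"
  proof -
    have "\<epsilon> * \<epsilon> \<le> \<epsilon>" "\<epsilon> * (\<epsilon> * \<epsilon>) \<le> \<epsilon>"
      using \<epsilon> by (auto intro!: mult_left_le mult_le_one)
    then have "(1 + \<epsilon>) ^ 3 \<le> 1 + 7 * \<epsilon>"
      by (simp add: power3_eq_cube algebra_simps)
    then show ?thesis using \<epsilon> by linarith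
  qed
  \<comment> \<open>The lower bound loses \<open>\<epsilon>\<close> in the Hoeffding deviation and a
    factor \<open>1 - \<epsilon>\<close> in the codegree.\<close>
  have low: "(1 - \<delta>) * a \<le> (a - \<epsilon>) * (1 - \<epsilon>)"
  proof -
    have "\<epsilon> * a \<le> \<epsilon>" "2 * \<epsilon> \<le> \<delta> * a" "0 < \<epsilon> * \<epsilon>"
      using \<epsilon> a mult_mono[of "7 * \<epsilon>" \<delta> "1 / 2" a] by (auto intro!: mult_left_le)
    then show ?thesis by (simp add: algebra_simps)
  qed
  have "\<forall>\<^sub>F n in at_top. \<forall>v\<in>V n. \<bar>real (vertex_degree (E n) v) - d n\<bar> \<le> \<epsilon> * \<bar>d n\<bar>"
    using degrees \<epsilon> by (simp add: unif_asymp_equiv_def)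
  moreover have "\<forall>\<^sub>F n in at_top. \<forall>u\<in>V n. \<forall>v\<in>V n. u \<noteq> v \<longrightarrow>
      \<bar>real (codegree (E n) u v) - (d n)\<^sup>2 / real n\<bar> \<le> \<epsilon> * \<bar>(d n)\<^sup>2 / real n\<bar>"
    using codegrees[unfolded unif_asymp_equiv_def, rule_format, OF \<epsilon>(1)]
    by (rule eventually_mono) auto
  \<comment> \<open>The union bound will ask for \<open>2 * ln n < \<epsilon>\<^sup>2 * M\<close>;
    the 3 makes this strict, since \<open>ln n > 0\<close>.\<close>
  moreover have "\<forall>\<^sub>F n in at_top. norm (ln (real n)) \<le> \<epsilon>\<^sup>2 / 3 * norm ((d n)\<^sup>2 / real n)"
    using \<epsilon> by (intro landau_o.smallD[OF large]) auto
  \<comment> \<open>The second condition is equivalent to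
    \<open>n \<le> (1 + \<epsilon>) * (n - 1)\<close>.\<close>
  moreover have "\<forall>\<^sub>F n in at_top. n \<ge> 2 \<and> real n \<ge> 1 + 1 / \<epsilon>"
    by (intro eventually_conj eventually_ge_at_top
        filterlim_real_sequentially[unfolded filterlim_at_top, rule_format])
  ultimately show "\<forall>\<^sub>F n in at_top. norm (real (kappa r 2 (V n) (E n)) - (1 - 1 / real r) * ((d n)\<^sup>2 / real n))
      \<le> \<delta> * norm ((1 - 1 / real r) * ((d n)\<^sup>2 / real n))"
  proof eventually_elim
    case (elim n)
    define M where "M = (d n)\<^sup>2 / real n"
    define k where "k = kappa r 2 (V n) (E n)"
    have n: "n \<ge> 2" "real n \<ge> 1 + 1 / \<epsilon>" using elim by auto
    then have lnpos: "ln (real n) > 0" by simp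
    have M0: "M \<ge> 0" by (simp add: M_def)
    have ln: "3 * ln (real n) \<le> \<epsilon>\<^sup>2 * M"
      using elim(3) lnpos M0 by (simp flip: M_def)
    then have M: "M > 0" using lnpos M0 by (cases "M = 0") auto
    have fin: "finite (kappa_set r 2 (V n) (E n))"
      using finite_kappa_set[OF graph] order n by simp
    have k_in: "k \<in> kappa_set r 2 (V n) (E n)"
      unfolding k_def kappa_def using fin zero_in_kappa_set[of r 2 "V n" "E n"] colors
      by (intro Max_in) auto
    have upper: "real k \<le> (1 + \<delta>) * (a * M)"
    proof -
      have deg: "(real (vertex_degree (E n) v))\<^sup>2 \<le> (1 + \<epsilon>)\<^sup>2 * (d n)\<^sup>2" if "v \<in> V n" for v
      proof -
        \<comment> \<open>The sign of \<open>d n\<close> is not prescribed; squaring removes the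
          absolute value.\<close>
        have "real (vertex_degree (E n) v) \<le> (1 + \<epsilon>) * \<bar>d n\<bar>"
          using elim(1) that by (fastforce simp: algebra_simps)
        then have "(real (vertex_degree (E n) v))\<^sup>2 \<le> ((1 + \<epsilon>) * \<bar>d n\<bar>)\<^sup>2"
          by (intro power_mono) auto
        then show ?thesis by (simp add: power_mult_distrib)
      qed
      have "real k * (real n - 1) \<le> a * ((1 + \<epsilon>)\<^sup>2 * (d n)\<^sup>2)"
        using kappa_set_2_upper[OF graph _ deg _ k_in] n colors by (simp add: order a_def)
      also have "\<dots> = a * (1 + \<epsilon>)\<^sup>2 * M * real n"
        using n by (simp add: M_def)
      also have "\<dots> \<le> a * (1 + \<epsilon>)\<^sup>2 * M * ((1 + \<epsilon>) * (real n - 1))"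
      proof (rule mult_left_mono)
        show "real n \<le> (1 + \<epsilon>) * (real n - 1)" using n \<epsilon> by (simp add: field_simps)
      qed (use a M in auto)
      finally have "real k * (real n - 1) \<le> (1 + \<epsilon>) ^ 3 * (a * M) * (real n - 1)"
        by (simp add: power2_eq_square power3_eq_cube mult_ac)
      then have "real k \<le> (1 + \<epsilon>) ^ 3 * (a * M)" using n by simp
      also have "\<dots> \<le> (1 + \<delta>) * (a * M)"
        using cube a M by (intro mult_right_mono) auto
      finally show ?thesis .
    qed
    have lower: "(1 - \<delta>) * (a * M) \<le> real k"
    proof -
      \<comment> \<open>Rounding up keeps \<open>t\<close> at least the target value, yet below it
        plus 1 as \<open>kappa_set_2_lower\<close> demands; \<open>nonneg\<close> makes
        \<open>nat\<close> harmless.\<close>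
      define t where "t = nat \<lceil>(a - \<epsilon>) * ((1 - \<epsilon>) * M)\<rceil>"
      have nonneg: "(a - \<epsilon>) * ((1 - \<epsilon>) * M) \<ge> 0" using a \<epsilon> M by simp
      have "t \<in> kappa_set r 2 (V n) (E n)"
      proof (rule kappa_set_2_lower[OF graph, where \<epsilon> = \<epsilon> and m = "(1 - \<epsilon>) * M"])
        show "(1 - \<epsilon>) * M \<le> real (codegree (E n) u v)"
          if "u \<in> V n" "v \<in> V n" "u \<noteq> v" for u v
          using elim(2) that M0 by (fastforce simp: algebra_simps simp flip: M_def)
        have "real n ^ 2 = exp (2 * ln (real n))"
          using n by (simp add: exp_double)
        moreover have "2 * ln (real n) < 2 * \<epsilon>\<^sup>2 * ((1 - \<epsilon>) * M)"
        proof -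
          have "2 * ln (real n) < \<epsilon>\<^sup>2 * M" using ln lnpos by linarith
          also have "\<dots> = 2 * \<epsilon>\<^sup>2 * (1 / 2 * M)" by simp
          also have "\<dots> \<le> 2 * \<epsilon>\<^sup>2 * ((1 - \<epsilon>) * M)"
            using \<epsilon> M by (intro mult_left_mono mult_right_mono) auto
          finally show ?thesis .
        qed
        ultimately show "(real (card (V n)))\<^sup>2 * exp (- 2 * \<epsilon>\<^sup>2 * ((1 - \<epsilon>) * M)) < 1"
          by (simp add: order flip: exp_add)
        show "real t < (1 - 1 / real r - \<epsilon>) * ((1 - \<epsilon>) * M) + 1"
          using nonneg unfolding t_def a_def[symmetric] by linarith
      qed (use colors \<epsilon> a M in \<open>auto simp flip: a_def\<close>)
      then have "t \<le> k" unfolding k_def kappa_def using fin by simp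
      have "(1 - \<delta>) * a * M \<le> (a - \<epsilon>) * (1 - \<epsilon>) * M"
        using low M by (intro mult_right_mono) auto
      also have "\<dots> \<le> real t" unfolding t_def by (simp add: mult.assoc) linarith
      finally show ?thesis using \<open>t \<le> k\<close> by (simp add: mult.assoc)
    qed
    have "a * M \<ge> 0" using a M by simp
    with upper lower show ?case
      unfolding a_def[symmetric] M_def[symmetric] k_def[symmetric]
      by (simp add: abs_le_iff algebra_simps)
  qed
qed

end
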